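(* Let $D\ge 1$ and $N>2D$ be integers, let $q$ be a prime power, let $\Gamma=J_q(N,D)$ with adjacency matrix $A$, and let $x$ be a vertex of $\Gamma$. For every subspace $\alpha\subseteq x$, with $i=\dim\alpha$, $$A\alpha^{\mathcal{N}}=[D-i]\bigl(q[N-D]-[D-i]\bigr)\alpha^{\mathcal{N}}+q^{2D-2i-1}[N-2D+i+1]\sum_{\substack{\beta\subseteq x,\\ \beta\text{ covers }\alpha}}\beta^{\mathcal{N}}+q^{D-i}\sum_{\substack{\beta\subseteq x,\\ \alpha\text{ covers }\alpha\cap\beta,\\ \beta\text{ covers }\alpha\cap\beta}}\beta^{\mathcal{N}}+[D-i+1]\sum_{\alpha\text{ covers }\beta}\beta^{\mathcal{N}}.$$
   Context: Let $\mathbb{F}_q$ be a finite field with $q$ elements and $\mathcal{V}$ an $N$-dimensional vector space over $\mathbb{F}_q$. The Grassmann graph $\Gamma=J_q(N,D)$ has vertex set $X$ consisting of the $D$-dimensional subspaces of $\mathcal{V}$; $y,z\in X$ are adjacent iff $\dim(y\cap z)=D-1$. $[\ell]=\frac{q^\ell-1}{q-1}$ for integers $\ell$. For subspaces $u,v$ of $\mathcal{V}$, $v$ covers $u$ means $u\subseteq v$ and $\dim v=\dim u+1$. Let $V=\mathbb{C}^X$ (column vectors), and for $y\in X$ let $\widehat y\in V$ have $1$ in coordinate $y$ and $0$ elsewhere. For a subspace $\alpha\subseteq x$, $\alpha^{\mathcal{N}}=\sum_{y\in X,\ y\cap x=\alpha}\widehat y$. All sums in the claim run over subspaces $\beta$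 with the indicated properties. *)

theory Defs
  imports Complex_Main "HOL-Library.Cardinality"
begin

text \<open>
  \<open>scale\<close> is the scalar multiplication of the ambient vector space.
  Elements of \<open>\<complex>\<^sup>X\<close>, where \<open>X\<close> is a finite set of subspaces, are represented by functions
  \<open>'v set \<Rightarrow> complex\<close> that vanish outside \<open>X\<close>; likewise for matrices with rows and
  columns indexed by \<open>X\<close>.
\<close>

definition grassmann_vertices ::
  "('f::field \<Rightarrow> 'v::ab_group_add \<Rightarrow> 'v) \<Rightarrow> nat \<Rightarrow> 'v set set" where
  "grassmann_vertices scale D =
     {y. module.subspace scale y \<and> vector_space.dim scale y = D}"

definition grassmann_adj ::
  "('f::field \<Rightarrow> 'v::ab_group_add \<Rightarrow> 'v) \<Rightarrow> nat \<Rightarrow> 'v set \<Rightarrow> 'v set \<Rightarrow> bool" where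
  "grassmann_adj scale D y z \<longleftrightarrow>
     y \<in> grassmann_vertices scale D \<and> z \<in> grassmann_vertices scale D \<and>
     vector_space.dim scale (y \<inter> z) = D - 1"

definition adjacency_matrix :: "('a \<Rightarrow> 'a \<Rightarrow> bool) \<Rightarrow> 'a \<Rightarrow> 'a \<Rightarrow> complex" where
  "adjacency_matrix adj y z = (if adj y z then 1 else 0)"

definition mat_vec ::
  "'a set \<Rightarrow> ('a \<Rightarrow> 'a \<Rightarrow> complex) \<Rightarrow> ('a \<Rightarrow> complex) \<Rightarrow> 'a \<Rightarrow> complex" where
  "mat_vec X M v = (\<lambda>y. \<Sum>z\<in>X. M y z * v z)"

definition hat :: "'a \<Rightarrow> 'a \<Rightarrow> complex" where
  "hat y = (\<lambda>z. if z = y then 1 else 0)"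

text \<open>Argument order: \<open>covers scale v u\<close> says that \<open>v\<close> covers \<open>u\<close>.\<close>

definition covers ::
  "('f::field \<Rightarrow> 'v::ab_group_add \<Rightarrow> 'v) \<Rightarrow> 'v set \<Rightarrow> 'v set \<Rightarrow> bool" where
  "covers scale v u \<longleftrightarrow>
     module.subspace scale u \<and> module.subspace scale v \<and>
     u \<subseteq> v \<and> vector_space.dim scale v = vector_space.dim scale u + 1"

definition N_vec ::
  "('f::field \<Rightarrow> 'v::ab_group_add \<Rightarrow> 'v) \<Rightarrow> nat \<Rightarrow> 'v set \<Rightarrow> 'v set \<Rightarrow> 'v set \<Rightarrow> complex" where
  "N_vec scale D x \<alpha> =
     (\<lambda>z. \<Sum>y | y \<in> grassmann_vertices scale D \<and> y \<inter> x = \<alpha>. hat y z)"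

definition q_int :: "nat \<Rightarrow> int \<Rightarrow> complex" where
  "q_int q l = (of_nat q powi l - 1) / (of_nat q - 1)"

end

theory Submission
  imports Defs
begin

text \<open>
  For a vertex \<open>z\<close>, the \<open>z\<close>-coordinate of \<open>A \<alpha>\<^sup>N\<close> is the number of
  neighbours \<open>y\<close> of \<open>z\<close> with \<open>y \<inter> x = \<alpha>\<close>. Group these by the hyperplane \<open>H = y \<inter> z\<close> of \<open>z\<close>,
  which satisfies \<open>H \<inter> x = \<alpha> \<inter> z\<close>; the number of admissible \<open>y\<close> does not depend on \<open>H\<close>.
  Both \<open>\<alpha>\<close> and \<open>z \<inter> x\<close> exceed \<open>\<alpha> \<inter> z\<close> by dimension at most one, and the four possibilities
  are the four terms of the right-hand side. If \<open>\<alpha>\<close> is not contained in \<open>z\<close>, then \<open>y = H + \<alpha>\<close> is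
  forced; otherwise \<open>y\<close> is any cover of \<open>H\<close> other than \<open>z\<close> that is not contained in \<open>H + x\<close>.
\<close>

section \<open>The \<open>q\<close>-integers [n] as natural numbers\<close>

definition gauss_number :: "nat \<Rightarrow> nat \<Rightarrow> nat" where
  "gauss_number q n = (\<Sum>k<n. q ^ k)"

lemma gauss_number_0 [simp]: "gauss_number q 0 = 0"
  by (simp add: gauss_number_def)

lemma gauss_number_Suc: "gauss_number q (Suc n) = gauss_number q n + q ^ n"
  by (simp add: gauss_number_def)

lemma gauss_number_add: "gauss_number q (m + n) = gauss_number q m + q ^ m * gauss_number q n"
  by (induction n) (simp_all add: gauss_number_Suc algebra_simps power_add)

lemma gauss_number_pos: "n > 0 \<Longrightarrow> gauss_number q n > 0"
  by (cases n) (simp_all add: gauss_number_def sum.lessThan_Suc_shift del: sum.lessThan_Suc)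

lemma gauss_number_mult: "q \<ge> 1 \<Longrightarrow> (q - 1) * gauss_number q n = q ^ n - 1"
proof (induction n)
  case (Suc n)
  then have "q ^ n \<ge> 1" "q * q ^ n \<ge> q ^ n" by auto
  with Suc show ?case by (simp add: gauss_number_Suc algebra_simps)
qed simp

text \<open>\<open>q \<ge> 2\<close> keeps the denominator nonzero. All \<open>q_int\<close>
  arguments in the theorem are nonnegative, so this makes them comparable with
  cardinalities.\<close>

lemma q_int_of_nat:
  assumes "q \<ge> 2"
  shows "q_int q (int n) = of_nat (gauss_number q n)"
proof -
  have "of_nat q ^ n - 1 = (of_nat q - 1 :: complex) * of_nat (gauss_number q n)"
  proof (induction n)
    case (Suc n)
    show ?case by (simp add: gauss_number_Suc distrib_left flip: Suc.IH) (simp add: algebra_simps)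
  qed simp
  moreover have "of_nat q - 1 \<noteq> (0 :: complex)"
    using assms by simp
  ultimately show ?thesis
    by (simp add: q_int_def power_int_of_nat)
qed

section \<open>Cardinalities of subspaces over a finite field\<close>

locale finite_vector_space = finite_dimensional_vector_space scale Basis
  for scale :: "'a::{field,finite} \<Rightarrow> 'b::ab_group_add \<Rightarrow> 'b" (infixr \<open>*s\<close> 75)
    and Basis :: "'b set"
begin

lemma card_field_ge_2: "CARD('a) \<ge> 2"
proof -
  have "card {0, 1 :: 'a} \<le> CARD('a)" by (rule card_mono) auto
  then show ?thesis by simp
qed

text \<open>Since \<open>a\<close> lies outside \<open>span S\<close>, the representation
  \<open>k *s a + s\<close> is unique.\<close>

lemma card_span_insert:
  assumes "a \<notin> span S"
  shows "card (span (insert a S)) = CARD('a) * card (span S)"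
proof -
  have "span (insert a S) = (\<lambda>(k, s). k *s a + s) ` (UNIV \<times> span S)"
  proof (intro equalityI subsetI)
    fix v assume "v \<in> span (insert a S)"
    then obtain k where "v - k *s a \<in> span S" by (auto simp: span_insert)
    then show "v \<in> (\<lambda>(k, s). k *s a + s) ` (UNIV \<times> span S)"
      by (intro image_eqI[of _ _ "(k, v - k *s a)"]) auto
  next
    fix v assume "v \<in> (\<lambda>(k, s). k *s a + s) ` (UNIV \<times> span S)"
    then obtain k s where "v = k *s a + s" "s \<in> span S" by auto
    then show "v \<in> span (insert a S)" unfolding span_insert by (auto intro: exI[of _ k])
  qed
  moreover have "inj_on (\<lambda>(k, s). k *s a + s) (UNIV \<times> span S)"
  proof (rule inj_onI, clarify)
    fix k l s t assume st: "s \<in> span S" "t \<in> span S" and eq: "k *s a + s = l *s a + t"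
    have *: "(k - l) *s a = t - s" using eq by (simp add: algebra_simps)
    have "k = l"
    proof (rule ccontr)
      assume "k \<noteq> l"
      then have "a = inverse (k - l) *s (t - s)" by (simp flip: *)
      then show False using assms st by (metis span_diff span_scale)
    qed
    with eq show "k = l \<and> s = t" by simp
  qed
  ultimately show ?thesis
    by (simp add: card_image card_cartesian_product)
qed

lemma card_subspace:
  assumes "subspace S"
  shows "card S = CARD('a) ^ dim S"
proof -
  obtain B where B: "B \<subseteq> S" "independent B" "S \<subseteq> span B" "card B = dim S"
    by (rule basis_exists)
  have "finite B" using B(2) by (rule finiteI_independent)
  then have "independent B \<longrightarrow> card (span B) = CARD('a) ^ card B"
    by (induction B) (auto simp: independent_insert card_span_insert)
  moreover have "span B = S"
    using B assms by (simp add: span_minimal subset_antisym)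
  ultimately show ?thesis using B by simp
qed

lemma finite_space: "finite (A :: 'b set)"
proof -
  \<comment> \<open>Infinite sets have \<open>card\<close> 0, whereas the whole space has a power of
    \<open>CARD('a)\<close> as its \<open>card\<close>.\<close>
  have "card (UNIV :: 'b set) \<noteq> 0" by (subst card_subspace) simp_all
  then show ?thesis by (metis card.infinite finite_subset subset_UNIV)
qed

lemma finite_sets: "finite (F :: 'b set set)"
  using finite_space[of UNIV] by (meson Finite_Set.finite_set finite_subset subset_UNIV)

section \<open>The covering relation; numbers of covers and hyperplanes\<close>

lemma coversD:
  assumes "covers scale v u"
  shows "subspace u" "subspace v" "u \<subseteq> v" "dim v = dim u + 1" "u \<noteq> v"
  using assms by (auto simp: covers_def)

lemma in_span_insert_iff:
  assumes "subspace S"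
  shows "v \<in> span (insert a S) \<longleftrightarrow> (\<exists>k. v - k *s a \<in> S)"
  using assms by (simp add: span_insert span_eq_iff[THEN iffD2])

lemma covers_span_insert:
  assumes "subspace u" "a \<notin> u"
  shows "covers scale (span (insert a u)) u"
  using assms by (auto simp: covers_def dim_insert span_eq_iff[THEN iffD2] intro: span_base)

text \<open>One vector outside \<open>u\<close> determines a cover of \<open>u\<close>, so distinct
  covers meet only in \<open>u\<close>.\<close>

lemma covers_eq_span_insert:
  assumes "covers scale v u" "a \<in> v" "a \<notin> u"
  shows "v = span (insert a u)"
proof -
  note c = coversD[OF assms(1)]
  have "span (insert a u) \<subseteq> v" using c assms by (simp add: span_minimal)
  then show ?thesis
    using c assms by (intro subspace_dim_equal[symmetric]) (simp_all add: dim_insert span_eq_iff[THEN iffD2])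
qed

text \<open>Any vector of \<open>w\<close> outside \<open>u\<close> already generates
  \<open>v\<close> over \<open>u\<close>.\<close>

lemma covers_between:
  assumes "covers scale v u" "u \<subseteq> w" "w \<subseteq> v" "subspace w"
  shows "w = u \<or> w = v"
proof (cases "w \<subseteq> u")
  case False
  then obtain a where a: "a \<in> w" "a \<notin> u" by auto
  then have "v = span (insert a u)" using assms covers_eq_span_insert by blast
  also have "\<dots> \<subseteq> w" using a assms by (simp add: span_minimal)
  finally show ?thesis using assms by auto
qed (use assms in auto)

text \<open>The sets \<open>v - u\<close> partition \<open>w - u\<close>. With d =
  \<open>dim u\<close> and e = \<open>dim w - dim u\<close>, each block has q^d (q - 1) vectors and
  \<open>w - u\<close> has q^d (q^e - 1), so there are [e] blocks.\<close>

lemma card_covers_within: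
  assumes "subspace u" "subspace w" "u \<subseteq> w"
  shows "card {v. covers scale v u \<and> v \<subseteq> w} = gauss_number CARD('a) (dim w - dim u)"
    (is "card ?C = _")
proof -
  have "w - u = (\<Union>v\<in>?C. v - u)"
  proof (intro equalityI subsetI)
    fix a assume a: "a \<in> w - u"
    then have "span (insert a u) \<in> ?C"
      using assms covers_span_insert by (simp add: span_minimal)
    then show "a \<in> (\<Union>v\<in>?C. v - u)" using a by (auto intro: span_base)
  qed auto
  moreover have "card (\<Union>v\<in>?C. v - u) = (\<Sum>v\<in>?C. card (v - u))"
  proof (intro card_UN_disjoint ballI impI finite_sets finite_space)
    fix v v' assume "v \<in> ?C" "v' \<in> ?C" "v \<noteq> v'"
    then have "v = v'" if "a \<in> v - u" "a \<in> v' - u" for a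
      using that covers_eq_span_insert[of v u a] covers_eq_span_insert[of v' u a] by simp
    with \<open>v \<noteq> v'\<close> show "(v - u) \<inter> (v' - u) = {}" by blast
  qed
  moreover have "(\<Sum>v\<in>?C. card (v - u)) = (\<Sum>v\<in>?C. CARD('a) ^ dim u * (CARD('a) - 1))"
  proof (rule sum.cong[OF refl])
    fix v assume "v \<in> ?C"
    then show "card (v - u) = CARD('a) ^ dim u * (CARD('a) - 1)"
      using coversD[of v u]
      by (simp add: card_Diff_subset finite_space card_subspace algebra_simps)
  qed
  moreover have "card (w - u) = CARD('a) ^ dim u * (CARD('a) ^ (dim w - dim u) - 1)"
    using assms dim_subset[of u w]
    by (simp add: card_Diff_subset finite_space card_subspace algebra_simps flip: power_add)
  moreover have "CARD('a) ^ (dim w - dim u) - 1 = (CARD('a) - 1) * gauss_number CARD('a) (dim w - dim u)"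
    using card_field_ge_2 by (intro gauss_number_mult[symmetric]) simp
  ultimately have "CARD('a) ^ dim u * (CARD('a) - 1) * card ?C =
      CARD('a) ^ dim u * (CARD('a) - 1) * gauss_number CARD('a) (dim w - dim u)"
    by (simp only: sum_constant mult.assoc of_nat_id) (simp only: mult_ac)
  moreover have "CARD('a) ^ dim u * (CARD('a) - 1) \<noteq> 0"
    using card_field_ge_2 by simp
  ultimately show ?thesis by (simp only: mult_cancel1 simp_thms)
qed

text \<open>
  By double counting the pairs \<open>v \<subseteq> h\<close> with \<open>v\<close> a cover of \<open>u\<close>, which reduces the codimension of \<open>u\<close>.
\<close>

lemma card_hyperplanes:
  assumes "subspace u" "subspace w" "u \<subseteq> w"
  shows "card {h. covers scale w h \<and> u \<subseteq> h} = gauss_number CARD('a) (dim w - dim u)"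
  using assms
proof (induction "dim w - dim u" arbitrary: u)
  case 0
  then have "{h. covers scale w h \<and> u \<subseteq> h} = {}"
    by (auto simp: covers_def dest: dim_subset)
  with 0(1) show ?case by (simp only: card.empty gauss_number_0 flip: 0(1))
next
  case (Suc n)
  note u = Suc.prems
  define A where "A = {h. covers scale w h \<and> u \<subseteq> h}"
  define B where "B = {v. covers scale v u \<and> v \<subseteq> w}"
  show ?case
  \<comment> \<open>Double counting gives [n] times the number of hyperplanes. As [0] = 0 cannot be
    cancelled, codimension one is treated directly.\<close>
  proof (cases "n = 0")
    case True
    then have d: "dim w = dim u + 1" using Suc.hyps by simp
    have "A = {u}"
    proof (intro equalityI subsetI)
      fix h assume "h \<in> A"
      then have "covers scale w h" "u \<subseteq> h" by (auto simp: A_def)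
      then have "u = h"
        using d u coversD[of w h] by (intro subspace_dim_equal) auto
      then show "h \<in> {u}" by simp
    qed (use d u in \<open>auto simp: A_def covers_def\<close>)
    then show ?thesis using True Suc.hyps by (simp add: A_def gauss_number_def flip: Suc.hyps)
  next
    case False
    have "(\<Sum>h\<in>A. card {v \<in> B. v \<subseteq> h}) = gauss_number CARD('a) n * card B"
    proof (rule sum_multicount[OF finite_sets finite_sets], rule ballI)
      fix v assume v: "v \<in> B"
      then have "card {h. covers scale w h \<and> v \<subseteq> h} = gauss_number CARD('a) (dim w - dim v)"
        using Suc.hyps u by (intro Suc.hyps) (auto simp: B_def covers_def)
      moreover have "{h \<in> A. v \<subseteq> h} = {h. covers scale w h \<and> v \<subseteq> h}"
        using v by (auto simp: A_def B_def covers_def)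
      moreover have "dim w - dim v = n"
        using v Suc.hyps by (auto simp: B_def covers_def)
      ultimately show "card {h \<in> A. v \<subseteq> h} = gauss_number CARD('a) n" by simp
    qed
    \<comment> \<open>The incidence relation has degree [n] on both sides, so \<open>A\<close> and
      \<open>B\<close> have equal size.\<close>
    moreover have "card {v \<in> B. v \<subseteq> h} = gauss_number CARD('a) n" if "h \<in> A" for h
    proof -
      have h: "covers scale w h" "u \<subseteq> h" using that by (auto simp: A_def)
      have "{v \<in> B. v \<subseteq> h} = {v. covers scale v u \<and> v \<subseteq> h}"
        using coversD(3)[OF h(1)] by (auto simp: B_def)
      moreover have "dim h - dim u = n" using coversD(4)[OF h(1)] Suc.hyps by simp
      ultimately show ?thesis
        using card_covers_within[OF u(1) coversD(1)[OF h(1)] h(2)] by simp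
    qed
    moreover have "card B = gauss_number CARD('a) (dim w - dim u)"
      unfolding B_def using u by (rule card_covers_within)
    moreover have "gauss_number CARD('a) n > 0" using False gauss_number_pos by simp
    ultimately show ?thesis unfolding A_def[symmetric] by simp
  qed
qed

text \<open>Removing the hyperplanes over \<open>v\<close> from those over \<open>u\<close> leaves
  [e + 1] - [e] = q^e, where e = \<open>dim w - dim v\<close>.\<close>

lemma card_hyperplanes_avoiding:
  assumes "covers scale v u" "subspace w" "v \<subseteq> w"
  shows "card {h. covers scale w h \<and> u \<subseteq> h \<and> \<not> v \<subseteq> h} = CARD('a) ^ (dim w - dim v)"
proof -
  note c = coversD[OF assms(1)]
  have "{h. covers scale w h \<and> u \<subseteq> h \<and> \<not> v \<subseteq> h} =
      {h. covers scale w h \<and> u \<subseteq> h} - {h. covers scale w h \<and> v \<subseteq> h}"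
    using c by auto
  moreover have "{h. covers scale w h \<and> v \<subseteq> h} \<subseteq> {h. covers scale w h \<and> u \<subseteq> h}"
    using c by auto
  moreover have "dim w - dim u = Suc (dim w - dim v)"
    using c dim_subset[OF assms(3)] by simp
  ultimately show ?thesis
    using card_hyperplanes[of u w] card_hyperplanes[of v w] c assms
    by (simp add: card_Diff_subset finite_sets gauss_number_Suc)
qed

section \<open>Neighbours of \<open>z\<close> with prescribed intersection with
  \<open>x\<close>\<close>

text \<open>A vector of \<open>y\<close> outside \<open>h\<close> that lies in h + x yields one of
  \<open>y \<inter> x\<close> outside \<open>h\<close>; conversely, the latter generates
  \<open>y\<close> over \<open>h\<close>. The bad covers of \<open>h\<close> are thus those inside a
  fixed subspace, which can be counted.\<close>

lemma cover_Int_eq_iff: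
  assumes "covers scale y h" "subspace x" "h \<inter> x = \<alpha>"
  shows "y \<inter> x = \<alpha> \<longleftrightarrow> \<not> y \<subseteq> {a + b |a b. a \<in> h \<and> b \<in> x}"
proof
  note c = coversD[OF assms(1)]
  assume eq: "y \<inter> x = \<alpha>"
  show "\<not> y \<subseteq> {a + b |a b. a \<in> h \<and> b \<in> x}"
  proof
    assume sub: "y \<subseteq> {a + b |a b. a \<in> h \<and> b \<in> x}"
    obtain v where v: "v \<in> y" "v \<notin> h" using c by blast
    with sub obtain a b where ab: "v = a + b" "a \<in> h" "b \<in> x" by blast
    have "b \<in> y" using ab v c subspace_diff[of y v a] by auto
    then have "b \<in> h" using ab eq assms by auto
    then show False using ab v c subspace_add by blast
  qed
next
  note c = coversD[OF assms(1)]
  assume n: "\<not> y \<subseteq> {a + b |a b. a \<in> h \<and> b \<in> x}"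
  have "y \<inter> x \<subseteq> h"
  proof (rule ccontr)
    assume "\<not> y \<inter> x \<subseteq> h"
    then obtain v where v: "v \<in> y" "v \<in> x" "v \<notin> h" by auto
    have "y = span (insert v h)" using covers_eq_span_insert assms v by blast
    also have "\<dots> \<subseteq> {a + b |a b. a \<in> h \<and> b \<in> x}"
    proof (rule span_minimal)
      show "insert v h \<subseteq> {a + b |a b. a \<in> h \<and> b \<in> x}"
        using v c assms subspace_0
        by (auto intro: exI[of _ 0]) (metis add.left_neutral add.right_neutral)+
      show "subspace {a + b |a b. a \<in> h \<and> b \<in> x}" using c assms by (intro subspace_sums)
    qed
    finally show False using n by simp
  qed
  then show "y \<inter> x = \<alpha>" using assms c by auto
qed

text \<open>The vertex dimension is read off \<open>z\<close>. If \<open>dim z = 0\<close>,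
  truncated subtraction admits \<open>y = z\<close>; hence \<open>dim z \<ge> 1\<close> is assumed
  where \<open>y \<inter> z\<close> has to be a hyperplane.\<close>

definition neighbours_over :: "'b set \<Rightarrow> 'b set \<Rightarrow> 'b set \<Rightarrow> 'b set set" where
  "neighbours_over x \<alpha> z =
     {y. subspace y \<and> dim y = dim z \<and> dim (y \<inter> z) = dim z - 1 \<and> y \<inter> x = \<alpha>}"

text \<open>With \<open>\<delta> = \<alpha> \<inter> z\<close> these are the candidates for
  \<open>y \<inter> z\<close>.\<close>

definition hyperplanes_over :: "'b set \<Rightarrow> 'b set \<Rightarrow> 'b set \<Rightarrow> 'b set set" where
  "hyperplanes_over x \<delta> z = {h. covers scale z h \<and> h \<inter> x = \<delta>}"

text \<open>For a cover \<open>y\<close> of \<open>h\<close>, \<open>y \<inter> z\<close> lies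
  between \<open>h\<close> and each of \<open>y\<close> and \<open>z\<close>, so it is
  \<open>h\<close> unless \<open>y = z\<close>.\<close>

lemma neighbours_over_fibre:
  assumes "subspace z" "dim z \<ge> 1" "covers scale z h"
  shows "{y \<in> neighbours_over x \<alpha> z. y \<inter> z = h} = {y. covers scale y h \<and> y \<noteq> z \<and> y \<inter> x = \<alpha>}"
proof (intro equalityI subsetI)
  note d = coversD[OF assms(3)]
  fix y assume "y \<in> {y \<in> neighbours_over x \<alpha> z. y \<inter> z = h}"
  then have y: "subspace y" "dim y = dim z" "y \<inter> z = h" "y \<inter> x = \<alpha>"
    by (simp_all add: neighbours_over_def)
  have "h \<subseteq> y" using y(3) by blast
  then have "covers scale y h" using d y(1,2) by (simp add: covers_def)
  moreover have "y \<noteq> z" using d(5) y(3) by auto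
  ultimately show "y \<in> {y. covers scale y h \<and> y \<noteq> z \<and> y \<inter> x = \<alpha>}"
    using y(4) by simp
next
  fix y assume "y \<in> {y. covers scale y h \<and> y \<noteq> z \<and> y \<inter> x = \<alpha>}"
  then have y: "covers scale y h" "y \<noteq> z" "y \<inter> x = \<alpha>" by auto
  note c = coversD[OF y(1)] and d = coversD[OF assms(3)]
  have "y \<inter> z = h"
  proof -
    have "y \<inter> z = h \<or> y \<inter> z = y"
      using c d y by (intro covers_between) (auto intro: subspace_inter)
    moreover have "y \<inter> z = h \<or> y \<inter> z = z"
      using c d assms by (intro covers_between) (auto intro: subspace_inter)
    ultimately show ?thesis using y(2) by auto
  qed
  then show "y \<in> {y \<in> neighbours_over x \<alpha> z. y \<inter> z = h}"
    using c d y by (auto simp: neighbours_over_def)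
qed

lemma hyperplane_Int_neighbour:
  assumes "y \<in> neighbours_over x \<alpha> z" "\<alpha> \<subseteq> x" "subspace z" "dim z \<ge> 1"
  shows "y \<inter> z \<in> hyperplanes_over x (\<alpha> \<inter> z) z"
  using assms by (auto simp: neighbours_over_def hyperplanes_over_def covers_def intro: subspace_inter)

lemma card_neighbours_over:
  assumes "\<alpha> \<subseteq> x" "subspace z" "dim z \<ge> 1"
    and fibre: "\<And>h. h \<in> hyperplanes_over x (\<alpha> \<inter> z) z \<Longrightarrow>
      card {y. covers scale y h \<and> y \<noteq> z \<and> y \<inter> x = \<alpha>} = c"
  shows "card (neighbours_over x \<alpha> z) = card (hyperplanes_over x (\<alpha> \<inter> z) z) * c"
proof -
  have "card (neighbours_over x \<alpha> z) = (\<Sum>y\<in>neighbours_over x \<alpha> z. 1)" by simp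
  also have "\<dots> = (\<Sum>h\<in>hyperplanes_over x (\<alpha> \<inter> z) z. \<Sum>y\<in>{y \<in> neighbours_over x \<alpha> z. y \<inter> z = h}. 1)"
    using assms hyperplane_Int_neighbour by (intro sum.group[symmetric] finite_sets) auto
  also have "\<dots> = (\<Sum>h\<in>hyperplanes_over x (\<alpha> \<inter> z) z. c)"
    using assms neighbours_over_fibre[of z _ x \<alpha>]
    by (intro sum.cong) (auto simp: hyperplanes_over_def)
  finally show ?thesis by simp
qed

lemma card_hyperplanes_over_eq:
  assumes "subspace x" "subspace z"
  shows "card (hyperplanes_over x (z \<inter> x) z) = gauss_number CARD('a) (dim z - dim (z \<inter> x))"
proof -
  have "hyperplanes_over x (z \<inter> x) z = {h. covers scale z h \<and> z \<inter> x \<subseteq> h}"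
    by (auto simp: hyperplanes_over_def covers_def)
  then show ?thesis using assms by (simp add: card_hyperplanes subspace_inter)
qed

text \<open>\<open>h \<inter> x\<close> lies between \<open>\<delta>\<close> and its cover
  \<open>z \<inter> x\<close> once \<open>h\<close> contains \<open>\<delta>\<close>, so it is
  \<open>\<delta>\<close> exactly when \<open>h\<close> avoids \<open>z \<inter> x\<close>.\<close>

lemma card_hyperplanes_over_covered:
  assumes "subspace x" "subspace z" "covers scale (z \<inter> x) \<delta>"
  shows "card (hyperplanes_over x \<delta> z) = CARD('a) ^ (dim z - dim (z \<inter> x))"
proof -
  note c = coversD[OF assms(3)]
  have "hyperplanes_over x \<delta> z = {h. covers scale z h \<and> \<delta> \<subseteq> h \<and> \<not> z \<inter> x \<subseteq> h}"
  proof (intro equalityI subsetI)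
    fix h assume "h \<in> {h. covers scale z h \<and> \<delta> \<subseteq> h \<and> \<not> z \<inter> x \<subseteq> h}"
    then have h: "covers scale z h" "\<delta> \<subseteq> h" "\<not> z \<inter> x \<subseteq> h" by auto
    note d = coversD[OF h(1)]
    have "h \<inter> x = \<delta> \<or> h \<inter> x = z \<inter> x"
      using c d h assms by (intro covers_between) (auto intro: subspace_inter)
    then show "h \<in> hyperplanes_over x \<delta> z" using h by (auto simp: hyperplanes_over_def)
  qed (use c in \<open>auto simp: hyperplanes_over_def\<close>)
  then show ?thesis using assms card_hyperplanes_avoiding by simp
qed

text \<open>Stated additively to avoid truncated subtraction.\<close>

lemma card_fibre_if_subset:
  assumes "subspace x" "dim x = dim z" "\<alpha> \<subseteq> z" "h \<in> hyperplanes_over x \<alpha> z"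
  shows "card {y. covers scale y h \<and> y \<noteq> z \<and> y \<inter> x = \<alpha>} + gauss_number CARD('a) (dim z - dim \<alpha>)
      + (if z \<inter> x = \<alpha> then 1 else 0) = gauss_number CARD('a) (dim (UNIV :: 'b set) + 1 - dim z)"
proof -
  have h: "covers scale z h" "h \<inter> x = \<alpha>" using assms by (auto simp: hyperplanes_over_def)
  note c = coversD[OF h(1)]
  define s where "s = {a + b |a b. a \<in> h \<and> b \<in> x}"
  define Y where "Y = {y. covers scale y h \<and> y \<noteq> z \<and> y \<inter> x = \<alpha>}"
  \<comment> \<open>\<open>z\<close> is itself a cover of \<open>h\<close>. If
    \<open>z \<inter> x = \<alpha>\<close> it has to be discounted separately; otherwise it lies in
    \<open>s\<close> and is discounted there.\<close>
  define Z where "Z = (if z \<inter> x = \<alpha> then {z} else {})"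
  have s: "subspace s" "h \<subseteq> s"
    unfolding s_def using c assms subspace_sums subspace_0[of x] by (auto intro: exI[of _ 0])
  have "dim s + dim \<alpha> = dim h + dim x"
    unfolding s_def using dim_sums_Int[of h x] c h assms by simp
  then have "dim s - dim h = dim z - dim \<alpha>" using assms(2) by arith
  then have "card {y. covers scale y h \<and> y \<subseteq> s} = gauss_number CARD('a) (dim z - dim \<alpha>)"
    using card_covers_within[OF c(1) s] by simp
  moreover have "card {y. covers scale y h} = gauss_number CARD('a) (dim (UNIV :: 'b set) - dim h)"
    using card_covers_within[of h UNIV] c by simp
  moreover have "{y. covers scale y h} = (Y \<union> {y. covers scale y h \<and> y \<subseteq> s}) \<union> Z"
    using h cover_Int_eq_iff[OF _ assms(1) h(2)] by (auto simp: Y_def Z_def s_def)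
  moreover have "Y \<inter> {y. covers scale y h \<and> y \<subseteq> s} = {}"
    using cover_Int_eq_iff[OF _ assms(1) h(2)] unfolding Y_def s_def by blast
  moreover have "(Y \<union> {y. covers scale y h \<and> y \<subseteq> s}) \<inter> Z = {}"
    using cover_Int_eq_iff[OF h(1) assms(1) h(2)] unfolding Y_def Z_def s_def by auto
  ultimately have "card Y + gauss_number CARD('a) (dim z - dim \<alpha>) + card Z =
      gauss_number CARD('a) (dim (UNIV :: 'b set) - dim h)"
    by (simp add: card_Un_disjoint finite_sets)
  moreover have "card Z = (if z \<inter> x = \<alpha> then 1 else 0)" by (simp add: Z_def)
  ultimately show ?thesis using c(4) by (simp add: Y_def)
qed

text \<open>Such a \<open>y\<close> contains \<open>h\<close> and a vector \<open>a\<close> of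
  \<open>\<alpha>\<close> outside \<open>z\<close>, hence is \<open>span (insert a h)\<close>. This
  span meets \<open>x\<close> in \<open>\<alpha>\<close>: subtracting a multiple of \<open>a\<close>
  moves a common vector into \<open>h \<inter> x = \<alpha> \<inter> z\<close>.\<close>

lemma card_fibre_if_not_subset:
  assumes "subspace x" "\<alpha> \<subseteq> x" "covers scale \<alpha> (\<alpha> \<inter> z)" "h \<in> hyperplanes_over x (\<alpha> \<inter> z) z"
  shows "card {y. covers scale y h \<and> y \<noteq> z \<and> y \<inter> x = \<alpha>} = 1"
proof -
  have h: "covers scale z h" "h \<inter> x = \<alpha> \<inter> z" using assms by (auto simp: hyperplanes_over_def)
  note c = coversD[OF h(1)] and d = coversD[OF assms(3)]
  obtain a where a: "a \<in> \<alpha>" "a \<notin> z" using d by blast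
  define y where "y = span (insert a h)"
  have y: "covers scale y h" unfolding y_def using a c covers_span_insert by blast
  have "y \<inter> x \<subseteq> \<alpha>"
  proof
    fix v assume v: "v \<in> y \<inter> x"
    then obtain k where k: "v - k *s a \<in> h" using c by (auto simp: y_def in_span_insert_iff)
    moreover have "v - k *s a \<in> x" using v a assms by (auto intro: subspace_diff subspace_scale)
    ultimately have "v - k *s a \<in> \<alpha>" using h by auto
    then have "v - k *s a + k *s a \<in> \<alpha>" using a d by (intro subspace_add subspace_scale)
    then show "v \<in> \<alpha>" by simp
  qed
  moreover have "\<alpha> \<subseteq> y"
  proof -
    have "\<alpha> = span (insert a (\<alpha> \<inter> z))" using a assms covers_eq_span_insert by blast
    also have "\<dots> \<subseteq> y" unfolding y_def using h by (intro span_mono) auto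
    finally show ?thesis .
  qed
  ultimately have "y \<inter> x = \<alpha>" "y \<noteq> z" using a assms(2) by blast+
  moreover have "y' = y" if "covers scale y' h" "y' \<inter> x = \<alpha>" for y'
    unfolding y_def using that a c(3) by (intro covers_eq_span_insert) auto
  ultimately have "{y. covers scale y h \<and> y \<noteq> z \<and> y \<inter> x = \<alpha>} = {y}"
    using y by blast
  then show ?thesis by simp
qed

text \<open>\<open>y\<close> and \<open>z\<close> both cover \<open>y \<inter> z\<close>;
  intersecting with \<open>x\<close> preserves a covering or turns it into an equality.\<close>

lemma covers_Int_if_neighbour:
  assumes "subspace x" "\<alpha> \<subseteq> x" "subspace z" "dim z \<ge> 1" "y \<in> neighbours_over x \<alpha> z"
  shows "\<alpha> \<inter> z = \<alpha> \<or> covers scale \<alpha> (\<alpha> \<inter> z)"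
    and "z \<inter> x = \<alpha> \<inter> z \<or> covers scale (z \<inter> x) (\<alpha> \<inter> z)"
proof -
  have meet: "u \<inter> w = h \<inter> w \<or> covers scale (u \<inter> w) (h \<inter> w)"
    if "covers scale u h" "subspace w" for u h w
  proof (cases "u \<inter> w \<subseteq> h")
    case False
    note c = coversD[OF that(1)]
    obtain a where a: "a \<in> u" "a \<in> w" "a \<notin> h" using False by auto
    have "u \<inter> w = span (insert a (h \<inter> w))"
    proof (intro equalityI subsetI)
      fix v assume v: "v \<in> u \<inter> w"
      then have "v \<in> span (insert a h)" using covers_eq_span_insert[OF that(1)] a by auto
      then obtain k where "v - k *s a \<in> h" using c by (auto simp: in_span_insert_iff)
      moreover have "v - k *s a \<in> w" using v a that by (auto intro: subspace_diff subspace_scale)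
      ultimately show "v \<in> span (insert a (h \<inter> w))"
        by (auto simp: span_insert intro!: exI[of _ k] span_base)
    next
      fix v assume "v \<in> span (insert a (h \<inter> w))"
      moreover have "span (insert a (h \<inter> w)) \<subseteq> u \<inter> w"
        using a c that by (intro span_minimal subspace_inter) auto
      ultimately show "v \<in> u \<inter> w" by auto
    qed
    moreover have "covers scale (span (insert a (h \<inter> w))) (h \<inter> w)"
      using a c that by (intro covers_span_insert subspace_inter) auto
    ultimately show ?thesis by simp
  qed (use coversD[OF that(1)] in auto)
  have y: "y \<inter> x = \<alpha>" "covers scale y (y \<inter> z)" "covers scale z (y \<inter> z)"
    using assms by (auto simp: neighbours_over_def covers_def intro: subspace_inter)
  have "(y \<inter> z) \<inter> x = \<alpha> \<inter> z" using y by auto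
  then show "\<alpha> \<inter> z = \<alpha> \<or> covers scale \<alpha> (\<alpha> \<inter> z)"
    "z \<inter> x = \<alpha> \<inter> z \<or> covers scale (z \<inter> x) (\<alpha> \<inter> z)"
    using meet[OF y(2) assms(1)] meet[OF y(3) assms(1)] y(1) by auto
qed

section \<open>Neighbour counts for the four positions of \<open>z\<close>\<close>

lemma card_neighbours_over_eq:
  assumes "subspace x" "dim x = D" "subspace z" "dim z = D" "D \<ge> 1" "z \<inter> x = \<alpha>"
  shows "card (neighbours_over x \<alpha> z) = gauss_number CARD('a) (D - dim \<alpha>) *
    (gauss_number CARD('a) (dim (UNIV :: 'b set) + 1 - D) - gauss_number CARD('a) (D - dim \<alpha>) - 1)"
proof -
  have "\<alpha> \<inter> z = \<alpha>" using assms by auto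
  moreover have "card {y. covers scale y h \<and> y \<noteq> z \<and> y \<inter> x = \<alpha>} =
      gauss_number CARD('a) (dim (UNIV :: 'b set) + 1 - D) - gauss_number CARD('a) (D - dim \<alpha>) - 1"
    if "h \<in> hyperplanes_over x \<alpha> z" for h
    using card_fibre_if_subset[of x z \<alpha> h] assms that by auto
  ultimately show ?thesis
    using card_hyperplanes_over_eq[of x z] assms card_neighbours_over[of \<alpha> x z] by auto
qed

text \<open>Here \<open>z \<inter> x\<close> has dimension \<open>dim \<alpha> + 1\<close>, whence
  the exponent. Unlike in the previous case, \<open>z\<close> needs no separate removal from the
  fibre.\<close>

lemma card_neighbours_over_covered:
  assumes "subspace x" "dim x = D" "subspace z" "dim z = D" "D \<ge> 1" "covers scale (z \<inter> x) \<alpha>"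
  shows "card (neighbours_over x \<alpha> z) = CARD('a) ^ (D - dim \<alpha> - 1) *
    (gauss_number CARD('a) (dim (UNIV :: 'b set) + 1 - D) - gauss_number CARD('a) (D - dim \<alpha>))"
proof -
  note c = coversD[OF assms(6)]
  have "\<alpha> \<inter> z = \<alpha>" using c by auto
  moreover have "card {y. covers scale y h \<and> y \<noteq> z \<and> y \<inter> x = \<alpha>} =
      gauss_number CARD('a) (dim (UNIV :: 'b set) + 1 - D) - gauss_number CARD('a) (D - dim \<alpha>)"
    if "h \<in> hyperplanes_over x \<alpha> z" for h
    using card_fibre_if_subset[of x z \<alpha> h] assms c that by auto
  ultimately show ?thesis
    using card_hyperplanes_over_covered[of x z \<alpha>] assms c card_neighbours_over[of \<alpha> x z] by auto
qed

lemma card_neighbours_over_exchange: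
  assumes "subspace x" "subspace z" "dim z = D" "D \<ge> 1" "\<alpha> \<subseteq> x"
    and "covers scale \<alpha> (\<alpha> \<inter> z)" "covers scale (z \<inter> x) (\<alpha> \<inter> z)"
  shows "card (neighbours_over x \<alpha> z) = CARD('a) ^ (D - dim \<alpha>)"
  using assms card_hyperplanes_over_covered[of x z "\<alpha> \<inter> z"] coversD(4)[OF assms(6)] coversD(4)[OF assms(7)]
    card_neighbours_over[of \<alpha> x z 1] card_fibre_if_not_subset[of x \<alpha> z]
  by simp

lemma card_neighbours_over_covering:
  assumes "subspace x" "subspace z" "dim z = D" "D \<ge> 1" "\<alpha> \<subseteq> x" "covers scale \<alpha> (z \<inter> x)"
  shows "card (neighbours_over x \<alpha> z) = gauss_number CARD('a) (D + 1 - dim \<alpha>)"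
proof -
  have eq: "\<alpha> \<inter> z = z \<inter> x" using coversD(3)[OF assms(6)] assms by auto
  have "D - dim (z \<inter> x) = D + 1 - dim \<alpha>" using coversD(4)[OF assms(6)] by simp
  then show ?thesis
    using assms card_hyperplanes_over_eq[of x z] eq
      card_neighbours_over[of \<alpha> x z 1] card_fibre_if_not_subset[of x \<alpha> z]
    by simp
qed

section \<open>Coordinates of both sides\<close>

lemma N_vec_eq:
  "N_vec scale D x \<alpha> z = (if z \<in> grassmann_vertices scale D \<and> z \<inter> x = \<alpha> then 1 else 0)"
  by (simp add: N_vec_def hat_def sum.delta' finite_sets)

text \<open>A vertex \<open>z\<close> is in the support of \<open>N_vec scale D x \<beta>\<close>
  only for \<open>\<beta> = z \<inter> x\<close>, so each sum of the theorem becomes an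
  indicator.\<close>

lemma sum_N_vec_eq:
  "(\<Sum>\<beta> | P \<beta>. N_vec scale D x \<beta> z) =
    (if z \<in> grassmann_vertices scale D \<and> P (z \<inter> x) then 1 else 0)"
proof -
  have "N_vec scale D x \<beta> z = (if z \<inter> x = \<beta> then of_bool (z \<in> grassmann_vertices scale D) else 0)" for \<beta>
    by (simp add: N_vec_eq)
  then show ?thesis by (simp add: sum.delta' finite_sets)
qed

lemma adjacency_N_vec_eq:
  "mat_vec (grassmann_vertices scale D) (adjacency_matrix (grassmann_adj scale D)) (N_vec scale D x \<alpha>) z =
    (if z \<in> grassmann_vertices scale D then of_nat (card (neighbours_over x \<alpha> z)) else 0)"
proof (cases "z \<in> grassmann_vertices scale D")
  case True
  have "mat_vec (grassmann_vertices scale D) (adjacency_matrix (grassmann_adj scale D)) (N_vec scale D x \<alpha>) z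
      = (\<Sum>y\<in>grassmann_vertices scale D. if y \<in> neighbours_over x \<alpha> z then 1 else 0)"
    unfolding mat_vec_def using True
    by (intro sum.cong)
      (auto simp: N_vec_eq adjacency_matrix_def grassmann_adj_def neighbours_over_def
        grassmann_vertices_def Int_commute)
  also have "\<dots> = of_nat (card (grassmann_vertices scale D \<inter> neighbours_over x \<alpha> z))"
    by (simp add: sum.If_cases finite_sets)
  also have "grassmann_vertices scale D \<inter> neighbours_over x \<alpha> z = neighbours_over x \<alpha> z"
    using True by (auto simp: grassmann_vertices_def neighbours_over_def)
  finally show ?thesis using True by simp
qed (simp add: mat_vec_def adjacency_matrix_def grassmann_adj_def)

end

section \<open>Comparison of coordinates\<close>

theorem theorem8p2:
  fixes scale :: "'f::{field,finite} \<Rightarrow> 'v::ab_group_add \<Rightarrow> 'v"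
    and q N D i :: nat
    and x \<alpha> :: "'v set"
  assumes "vector_space scale"
    and "q = CARD('f)"
    and "vector_space.dim scale (UNIV :: 'v set) = N"
    and "D \<ge> 1" and "N > 2 * D"
    and "x \<in> grassmann_vertices scale D"
    and "module.subspace scale \<alpha>" and "\<alpha> \<subseteq> x"
    and "i = vector_space.dim scale \<alpha>"
  shows "mat_vec (grassmann_vertices scale D) (adjacency_matrix (grassmann_adj scale D))
           (N_vec scale D x \<alpha>) =
    (\<lambda>z. q_int q (int D - int i)
            * (of_nat q * q_int q (int N - int D) - q_int q (int D - int i))
            * N_vec scale D x \<alpha> z
       + of_nat q powi (2 * int D - 2 * int i - 1) * q_int q (int N - 2 * int D + int i + 1)
            * (\<Sum>\<beta> | module.subspace scale \<beta> \<and> \<beta> \<subseteq> x \<and> covers scale \<beta> \<alpha>.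
                 N_vec scale D x \<beta> z)
       + of_nat q powi (int D - int i)
            * (\<Sum>\<beta> | module.subspace scale \<beta> \<and> \<beta> \<subseteq> x \<and>
                     covers scale \<alpha> (\<alpha> \<inter> \<beta>) \<and> covers scale \<beta> (\<alpha> \<inter> \<beta>).
                 N_vec scale D x \<beta> z)
       + q_int q (int D - int i + 1)
            * (\<Sum>\<beta> | module.subspace scale \<beta> \<and> covers scale \<alpha> \<beta>. N_vec scale D x \<beta> z))"
proof -
  interpret vs: vector_space scale by fact
  obtain B where B: "vs.independent B" "UNIV \<subseteq> vs.span B" "card B = vs.dim UNIV"
    using vs.basis_exists[of UNIV] by metis
  interpret finite_vector_space scale B
  proof
    \<comment> \<open>\<open>card B = N\<close> is positive because
      \<open>N > 2 * D\<close>.\<close>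
    show "finite B" using B(3) assms(3,5) by (intro card_ge_0_finite) simp
  qed (use B in auto)
  have x: "vs.subspace x" "vs.dim x = D" and \<alpha>: "vs.subspace \<alpha>" "\<alpha> \<subseteq> x" "i \<le> D"
    using assms dim_subset[of \<alpha> x] by (auto simp: grassmann_vertices_def)
  have q: "q \<ge> 2" using card_field_ge_2 assms(2) by simp
  define g :: "nat \<Rightarrow> complex" where "g n = of_nat (gauss_number q n)" for n
  have q_int_g: "q_int q l = g n" if "l = int n" for l n
    using q_int_of_nat[OF q] that by (simp add: g_def)
  have coeff1: "q_int q (int D - int i) = g (D - i)" "q_int q (int N - int D) = g (N - D)"
    "q_int q (int D - int i + 1) = g (D + 1 - i)"
    "q_int q (int N - 2 * int D + int i + 1) = g (N + i + 1 - 2 * D)"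
    using \<alpha>(3) assms(5) by (intro q_int_g; simp)+
  \<comment> \<open>The other exponent, 2D - 2i - 1, is -1 for \<open>i = D\<close>; it stays an
    integer power until the case \<open>covered\<close>, where \<open>i < D\<close>.\<close>
  have coeff2: "of_nat q powi (int D - int i) = (of_nat q ^ (D - i) :: complex)"
    using \<alpha>(3) by (simp flip: of_nat_diff power_int_of_nat)
  show ?thesis
  proof (rule ext, goal_cases)
    case (1 z)
    show ?case
    proof (cases "z \<in> grassmann_vertices scale D")
      case False
      then show ?thesis unfolding adjacency_N_vec_eq sum_N_vec_eq by (simp add: N_vec_eq)
    next
      case True
      then have z: "vs.subspace z" "vs.dim z = D" by (auto simp: grassmann_vertices_def)
      define \<gamma> where "\<gamma> = z \<inter> x"
      have int: "\<alpha> \<inter> z = \<alpha> \<inter> \<gamma>" and \<gamma>: "\<gamma> \<subseteq> x" "vs.subspace \<gamma>"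
        using \<alpha> x z by (auto simp: \<gamma>_def intro: vs.subspace_inter)
      define c where "c = card (neighbours_over x \<alpha> z)"
      \<comment> \<open>This makes the four indicators mutually exclusive, so at most one summand
        survives.\<close>
      have excl: "\<not> covers scale u v" if "u \<subseteq> v" for u v :: "'v set"
        using that dim_subset[of u v] by (auto simp: covers_def)
      have "of_nat c =
          g (D - i) * (of_nat q * g (N - D) - g (D - i)) * (if \<gamma> = \<alpha> then 1 else 0)
          + of_nat q powi (2 * int D - 2 * int i - 1) * g (N + i + 1 - 2 * D)
            * (if covers scale \<gamma> \<alpha> then 1 else 0)
          + of_nat q ^ (D - i)
            * (if covers scale \<alpha> (\<alpha> \<inter> \<gamma>) \<and> covers scale \<gamma> (\<alpha> \<inter> \<gamma>) then 1 else 0)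
          + g (D + 1 - i) * (if covers scale \<alpha> \<gamma> then 1 else 0)"
      proof -
        consider (eq) "\<gamma> = \<alpha>" | (covered) "covers scale \<gamma> \<alpha>"
          | (exchange) "covers scale \<alpha> (\<alpha> \<inter> \<gamma>)" "covers scale \<gamma> (\<alpha> \<inter> \<gamma>)"
          | (covering) "covers scale \<alpha> \<gamma>"
          | (none) "\<gamma> \<noteq> \<alpha>" "\<not> covers scale \<gamma> \<alpha>" "\<not> covers scale \<alpha> \<gamma>"
            "\<not> (covers scale \<alpha> (\<alpha> \<inter> \<gamma>) \<and> covers scale \<gamma> (\<alpha> \<inter> \<gamma>))"
          by blast
        then show ?thesis
        proof cases
          case eq
          have "gauss_number q (N + 1 - D) = 1 + q * gauss_number q (N - D)"
            using gauss_number_add[of q 1 "N - D"] assms(5)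
            by (simp add: gauss_number_Suc Suc_diff_le)
          \<comment> \<open>The truncated subtraction in the count is thereby a true one;
            \<open>N > 2 * D\<close> gives D - i \<le> N - D.\<close>
          moreover have "gauss_number q (D - i) \<le> q * gauss_number q (N - D)"
          proof -
            have "gauss_number q (D - i) \<le> gauss_number q (N - D)"
              using gauss_number_add[of q "D - i" "N + i - 2 * D"] \<alpha>(3) assms(5) by simp
            also have "\<dots> \<le> q * gauss_number q (N - D)" using q by simp
            finally show ?thesis .
          qed
          moreover have "c = gauss_number q (D - i) *
              (gauss_number q (N + 1 - D) - gauss_number q (D - i) - 1)"
            using card_neighbours_over_eq[of x D z \<alpha>] x z eq assms by (simp add: c_def \<gamma>_def)
          ultimately have "of_nat c = g (D - i) * (of_nat q * g (N - D) - g (D - i))"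
            by (simp add: g_def of_nat_diff)
          then show ?thesis using eq excl by simp
        next
          case covered
          note d = coversD[OF covered]
          have "vs.dim \<gamma> \<le> D" using \<gamma> x dim_subset by blast
          then have i: "i < D" using d assms(9) by simp
          \<comment> \<open>Splitting off the first D - i terms cancels the subtrahend and leaves a
            factor q^(D - i), which doubles up with q^(D - i - 1).\<close>
          then have "gauss_number q (N + 1 - D) =
              gauss_number q (D - i) + q ^ (D - i) * gauss_number q (N + i + 1 - 2 * D)"
            using gauss_number_add[of q "D - i" "N + i + 1 - 2 * D"] assms(5) by simp
          moreover have "c = q ^ (D - i - 1) *
              (gauss_number q (N + 1 - D) - gauss_number q (D - i))"
            using card_neighbours_over_covered[of x D z \<alpha>] x z covered assms
            by (simp add: c_def \<gamma>_def)
          ultimately have "c = q ^ (D - i - 1 + (D - i)) * gauss_number q (N + i + 1 - 2 * D)"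
            by (simp only: power_add add_diff_cancel_left' mult.assoc)
          moreover have "2 * int D - 2 * int i - 1 = int (D - i - 1 + (D - i))"
            using i by simp
          ultimately have "of_nat c =
              of_nat q powi (2 * int D - 2 * int i - 1) * g (N + i + 1 - 2 * D)"
            by (simp only: g_def power_int_of_nat of_nat_mult of_nat_power)
          moreover have "\<gamma> \<noteq> \<alpha>" "\<alpha> \<inter> \<gamma> = \<alpha>" using d by auto
          ultimately show ?thesis using covered excl d by simp
        next
          case exchange
          then have "c = q ^ (D - i)"
            using card_neighbours_over_exchange[of x z D \<alpha>] x z \<alpha> int assms
            by (simp add: c_def \<gamma>_def)
          \<comment> \<open>Were one contained in the other, it would equal
            \<open>\<alpha> \<inter> \<gamma>\<close> and cover itself.\<close>
          moreover have "\<not> \<gamma> \<subseteq> \<alpha>" "\<not> \<alpha> \<subseteq> \<gamma>"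
            using exchange excl by (auto simp: Int_absorb1 Int_absorb2)
          then have "\<gamma> \<noteq> \<alpha>" "\<not> covers scale \<gamma> \<alpha>" "\<not> covers scale \<alpha> \<gamma>"
            by (auto simp: covers_def)
          ultimately show ?thesis using exchange by simp
        next
          case covering
          note d = coversD[OF covering]
          have "c = gauss_number q (D + 1 - i)"
            using card_neighbours_over_covering[of x z D \<alpha>] x z \<alpha> covering assms
            by (simp add: c_def \<gamma>_def)
          moreover have "\<gamma> \<noteq> \<alpha>" "\<alpha> \<inter> \<gamma> = \<gamma>" using d by auto
          ultimately show ?thesis using covering excl d by (simp add: g_def)
        next
          case none
          \<comment> \<open>A neighbour would force each of \<open>\<alpha>\<close> and
            \<open>\<gamma>\<close> to equal or cover \<open>\<alpha> \<inter> \<gamma>\<close>; the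
            four combinations are the four preceding cases.\<close>
          have "neighbours_over x \<alpha> z = {}"
          proof (rule ccontr)
            assume "neighbours_over x \<alpha> z \<noteq> {}"
            then obtain y where "y \<in> neighbours_over x \<alpha> z" by auto
            from covers_Int_if_neighbour[OF x(1) \<alpha>(2) z(1) _ this] assms(4) z(2)
            have "\<alpha> \<inter> \<gamma> = \<alpha> \<or> covers scale \<alpha> (\<alpha> \<inter> \<gamma>)" "\<gamma> = \<alpha> \<inter> \<gamma> \<or> covers scale \<gamma> (\<alpha> \<inter> \<gamma>)"
              by (auto simp: int \<gamma>_def[symmetric])
            then show False using none by metis
          qed
          then show ?thesis using none by (auto simp: c_def)
        qed
      qed
      then show ?thesis
        using True \<alpha> \<gamma>
        unfolding adjacency_N_vec_eq sum_N_vec_eq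
        by (simp add: N_vec_eq coeff1 coeff2 c_def \<gamma>_def[symmetric])
    qed
  qed
qed

end
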